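(* Let $u^{\rm true}\in\mathcal{X}$, $\xi>0$, and let $y_m=\ell_m^o(u^{\rm true})+\epsilon_m$, $m=1,\ldots,M$, where $\epsilon_1,\ldots,\epsilon_M$ are independent realizations of a random variable $\epsilon$ with mean $0$ and variance $\sigma^2$. Let $\mathbf{y}=[y_1,\ldots,y_M]^T$ and $\mathbf{y}^{\rm true}=[\ell_1^o(u^{\rm true}),\ldots,\ell_M^o(u^{\rm true})]^T$. Let $\mathbf{u}_\xi^\star=[\tilde{\boldsymbol{\eta}}_\xi^\star,\mathbf{z}_\xi^\star]\in\mathbb{R}^{M+N}$ and $\mathbf{u}^{\rm opt}=[\tilde{\boldsymbol{\eta}}^{\rm opt},\mathbf{z}^{\rm opt}]\in\mathbb{R}^{M+N}$ be the solutions to $$\mathbb{A}(\xi)\,\mathbf{u}_\xi^\star=\begin{bmatrix}\mathbf{y}\\ \mathbf{0}\end{bmatrix},\qquad \mathbb{A}(0)\,\mathbf{u}^{\rm opt}=\begin{bmatrix}\mathbf{y}^{\rm true}\\ \mathbf{0}\end{bmatrix},\qquad \mathbb{A}(\xi)=\begin{bmatrix}\xi M\mathbb{I}+\mathbb{L}_\eta\mathbb{L}_\eta^T & \mathbb{L}_z\\ \mathbb{L}_z^T & 0\end{bmatrix}.$$ Then $$\big\|\mathbb{E}[\mathbf{u}_\xi^\star]-\mathbf{u}^{\rm opt}\big\|_2\ \le\ \frac{\xi M}{s_{\rm min}(\mathbb{A}(\xi))}\,\|\tilde{\boldsymbol{\eta}}^{\rm opt}\|_2$$ and $$\mathbb{E}\big[\|\mathbf{u}_\xi^\star-\mathbf{u}^{\rm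 opt}\|_2^2\big]\ \le\ \left(\frac{\xi M}{s_{\rm min}(\mathbb{A}(\xi))}\,\|\tilde{\boldsymbol{\eta}}^{\rm opt}\|_2\right)^2+\sigma^2\,{\rm trace}\left(\mathbb{A}(\xi)^{-1}\,\Sigma\,\mathbb{A}(\xi)^{-T}\right),$$ where $s_{\rm min}(\mathbb{A}(\xi))$ is the minimum singular value of $\mathbb{A}(\xi)$ and $\Sigma=\begin{bmatrix}\mathbb{I}&0\\0&0\end{bmatrix}\in\mathbb{R}^{(M+N)\times(M+N)}$, with $\mathbb{I}$ the $M\times M$ identity.
   Context: $\mathcal{X}$ is a real Hilbert space with inner product $(\cdot,\cdot)$ and norm $\|\cdot\|$; $\ell_1^o,\ldots,\ell_M^o\in\mathcal{X}'$ are observation functionals. $\mathcal{Z}_N\subset\mathcal{X}$ is an $N$-dimensional subspace with orthonormal basis $\zeta_1,\ldots,\zeta_N$ and $\mathcal{U}_M\subset\mathcal{X}$ is an $M$-dimensional subspace with orthonormal basis $\psi_1,\ldots,\psi_M$ (orthonormality with respect to $(\cdot,\cdot)$). The matrices $\mathbb{L}_z\in\mathbb{R}^{M\times N}$ and $\mathbb{L}_\eta\in\mathbb{R}^{M\times M}$ are $(\mathbb{L}_z)_{m,n}=\ell_m^o(\zeta_n)$ and $(\mathbb{L}_\eta)_{m,m'}=\ell_m^o(\psi_{m'})$. Standing assumptions: (i) unisolvency: if $\psi\in\mathcal{U}_M$ and $\ell_m^o(\psi)=0$ for $m=1,\ldots,M$, then $\psi\equiv0$ (so $\mathbb{L}_\eta$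 is invertible); (ii) $\mathbb{L}_z$ has rank $N$. (Condition (ii) is equivalent to the positivity of the inf-sup constant $\beta_{N,M}$ of the method.) Under these assumptions $\mathbb{A}(\xi)$ is invertible for every $\xi\ge0$. Interpretation: $\mathbf{u}_\xi^\star$ is the coefficient vector of the solution to the regularized problem $\min_{(z,\eta)\in\mathcal{Z}_N\times\mathcal{U}_M}\xi\|\eta\|^2+\frac1M\sum_{m=1}^M(\ell_m^o(z+\eta)-y_m)^2$, with $z=\sum_n(\mathbf{z}_\xi^\star)_n\zeta_n$, $\eta=\sum_m(\boldsymbol{\eta}_\xi^\star)_m\psi_m$, $\boldsymbol{\eta}_\xi^\star=\mathbb{L}_\eta^T\tilde{\boldsymbol{\eta}}_\xi^\star$; $\mathbf{u}^{\rm opt}$ is the analogous coefficient vector for the noise-free constrained problem of minimizing $\|\eta\|$ over $\mathcal{Z}_N\times\mathcal{U}_M$ subject to $\ell_m^o(z+\eta)=\ell_m^o(u^{\rm true})$, $m=1,\ldots,M$. $\mathbb{E}$ denotes expectation and $\|\cdot\|_2$ the Euclidean norm. *)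

theory Defs
  imports "HOL-Probability.Probability"
begin

text \<open>The dimension of \<open>S\<close> is the cardinality of the index type \<open>'n\<close>, since an orthonormal
  family is linearly independent and injective.\<close>

definition orthonormal_basis_of :: "('n::finite \<Rightarrow> 'x::real_inner) \<Rightarrow> 'x set \<Rightarrow> bool" where
  "orthonormal_basis_of b S \<longleftrightarrow>
     (\<forall>i j. b i \<bullet> b j = (if i = j then 1 else 0)) \<and> span (range b) = S"

definition observation_matrix ::
    "('m::finite \<Rightarrow> ('x::real_inner \<Rightarrow>\<^sub>L real)) \<Rightarrow> ('n::finite \<Rightarrow> 'x) \<Rightarrow> real ^ 'n ^ 'm" where
  "observation_matrix ell b = (\<chi> i j. blinfun_apply (ell i) (b j))"

definition block_vec :: "real ^ 'm \<Rightarrow> real ^ 'n \<Rightarrow> real ^ ('m::finite + 'n::finite)" where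
  "block_vec x y = (\<chi> i. case i of Inl a \<Rightarrow> x $ a | Inr b \<Rightarrow> y $ b)"

definition block_mat ::
    "real ^ 'm ^ 'm \<Rightarrow> real ^ 'n ^ 'm \<Rightarrow> real ^ 'm ^ 'n \<Rightarrow> real ^ 'n ^ 'n
      \<Rightarrow> real ^ ('m::finite + 'n::finite) ^ ('m + 'n)" where
  "block_mat A B C D = (\<chi> i j.
     case i of
       Inl a \<Rightarrow> (case j of Inl c \<Rightarrow> A $ a $ c | Inr d \<Rightarrow> B $ a $ d)
     | Inr b \<Rightarrow> (case j of Inl c \<Rightarrow> C $ b $ c | Inr d \<Rightarrow> D $ b $ d))"

definition saddle_matrix ::
    "real ^ 'm ^ 'm \<Rightarrow> real ^ 'n ^ 'm \<Rightarrow> real \<Rightarrow> real ^ ('m::finite + 'n::finite) ^ ('m + 'n)" where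
  "saddle_matrix L\<eta> Lz \<xi> =
     block_mat ((\<xi> * real CARD('m)) *\<^sub>R mat 1 + L\<eta> ** transpose L\<eta>) Lz (transpose Lz) 0"

text \<open>The singular values of a square matrix \<open>A\<close> are the nonnegative square roots of the
  eigenvalues of \<open>A\<^sup>T A\<close>. This set is always finite and nonempty, so the minimum below is
  well defined.\<close>

definition singular_values :: "real ^ 'n ^ 'n \<Rightarrow> real set" where
  "singular_values A =
     {s. s \<ge> 0 \<and> (\<exists>v. v \<noteq> 0 \<and> (transpose A ** A) *v v = s\<^sup>2 *\<^sub>R v)}"

definition s_min :: "real ^ 'n ^ 'n \<Rightarrow> real" where
  "s_min A = Min (singular_values A)"

end

theory Submission
  imports Defs
begin

text \<open>Since \<open>A(\<xi>)\<close> and \<open>A(0)\<close> differ only by \<open>\<xi> M\<close> times the identity in the first block, \<open>A(\<xi>)\<close>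
  maps the error \<open>u_star - u_opt\<close> to \<open>(\<epsilon> - \<xi> M \<eta>_opt, 0)\<close>. The error is therefore a deterministic
  bias, bounded through the operator norm \<open>1 / s_min\<close> of the inverse matrix, plus a linear image of
  centred uncorrelated noise. The cross terms vanish in expectation, and the noise contributes
  \<open>\<sigma>\<^sup>2\<close> times the squared Frobenius norm of the first block column of the inverse, which is the
  trace.\<close>

subsection \<open>Singular values\<close>

lemma inner_matrix_vector_mult:
  fixes A :: "real ^ 'n ^ 'm"
  shows "(A *v x) \<bullet> y = x \<bullet> (transpose A *v y)"
  by (metis dot_lmul_matrix inner_commute transpose_matrix_vector)

lemma matrix_inv_invertible:
  fixes A :: "'a::semiring_1 ^ 'n ^ 'm"
  assumes "invertible A"
  shows "A ** matrix_inv A = mat 1" "matrix_inv A ** A = mat 1"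
  using someI_ex[OF assms[unfolded invertible_def]] by (simp_all add: matrix_inv_def)

text \<open>Eigenvectors of the symmetric matrix \<open>S\<close> for distinct eigenvalues are
  orthogonal, so choosing one for each singular value gives an independent family, whose size is
  bounded by the dimension. Finiteness is what gives \<open>Min\<close> in \<open>s_min\<close> its
  meaning.\<close>

lemma finite_singular_values:
  fixes A :: "real ^ 'n ^ 'n"
  shows "finite (singular_values A)"
proof -
  define S where "S = transpose A ** A"
  have sym: "(S *v v) \<bullet> w = v \<bullet> (S *v w)" for v w
    by (simp add: S_def inner_matrix_vector_mult matrix_transpose_mul
        del: transpose_matrix_vector)
  obtain v where v: "v s \<noteq> 0" "S *v v s = s\<^sup>2 *\<^sub>R v s" if "s \<in> singular_values A" for s
    using bchoice[of "singular_values A" "\<lambda>s v. v \<noteq> 0 \<and> S *v v = s\<^sup>2 *\<^sub>R v"]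
    unfolding singular_values_def S_def by blast
  have orth: "v s \<bullet> v t = 0"
    if "s \<in> singular_values A" "t \<in> singular_values A" "s \<noteq> t" for s t
  proof -
    have "s\<^sup>2 * (v s \<bullet> v t) = t\<^sup>2 * (v s \<bullet> v t)"
      using sym[of "v s" "v t"] v(2)[OF that(1)] v(2)[OF that(2)] by simp
    \<comment> \<open>Squaring is injective on singular values because they are nonnegative.\<close>
    moreover have "s\<^sup>2 \<noteq> t\<^sup>2"
      using that by (auto simp: singular_values_def power2_eq_iff_nonneg)
    ultimately show ?thesis by simp
  qed
  have inj: "inj_on v (singular_values A)"
    using orth v(1) by (metis inj_onI inner_eq_zero_iff)
  have "independent (v ` singular_values A)"
    using orth v(1)
    by (intro pairwise_orthogonal_independent) (auto simp: pairwise_def orthogonal_def)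
  then have "finite (v ` singular_values A)"
    using independent_bound by blast
  then show ?thesis
    using inj finite_imageD by blast
qed

text \<open>A minimizer of the Rayleigh quotient of \<open>A\<^sup>T A\<close> is an eigenvector, because the nonnegative
  quadratic form \<open>\<parallel>A v\<parallel>\<^sup>2 - s\<^sup>2 \<parallel>v\<parallel>\<^sup>2\<close> vanishes, hence is stationary, there.\<close>

lemma singular_value_lower_bound:
  fixes A :: "real ^ 'n ^ 'n"
  obtains s where "s \<in> singular_values A" "\<And>v. s * norm v \<le> norm (A *v v)"
proof -
  have "continuous_on (sphere 0 1) (\<lambda>v. norm (A *v v))"
    by (intro continuous_intros matrix_vector_mult_linear_continuous_on)
  moreover have "sphere (0 :: real ^ 'n) 1 \<noteq> {}"
    by simp
  ultimately obtain u where u: "norm u = 1"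
    and min: "\<And>v. norm v = 1 \<Longrightarrow> norm (A *v u) \<le> norm (A *v v)"
    using continuous_attains_inf[of "sphere (0 :: real ^ 'n) 1" "\<lambda>v. norm (A *v v)"] by auto
  define s where "s = norm (A *v u)"
  have bound: "s * norm v \<le> norm (A *v v)" for v
  proof (cases "v = 0")
    case False
    then have "s \<le> norm (A *v (inverse (norm v) *\<^sub>R v))"
      unfolding s_def by (intro min) simp
    also have "\<dots> = norm (A *v v) / norm v"
      by (simp add: matrix_vector_mult_scaleR divide_inverse)
    finally show ?thesis
      using False by (simp add: field_simps)
  qed simp
  \<comment> \<open>\<open>r\<close> is half the gradient at \<open>u\<close> of the quadratic form
    \<parallel>A v\<parallel>^2 - s^2 \<parallel>v\<parallel>^2, and \<open>d\<close> is the value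
    of that form at \<open>r\<close>.\<close>
  define r where "r = (transpose A ** A) *v u - s\<^sup>2 *\<^sub>R u"
  define d where "d = (norm (A *v r))\<^sup>2 - s\<^sup>2 * (norm r)\<^sup>2"
  have d: "d \<ge> 0"
    using power_mono[OF bound[of r], of 2] by (simp add: d_def s_def power_mult_distrib)
  have adj: "(A *v u) \<bullet> (A *v r) = ((transpose A ** A) *v u) \<bullet> r"
    by (metis inner_commute inner_matrix_vector_mult matrix_vector_mul_assoc)
  \<comment> \<open>The right-hand side is the form at \<open>u + t r\<close>: its constant term
    vanishes since the form is zero at \<open>u\<close>, and its linear coefficient is twice the
    pairing of \<open>r\<close> with itself.\<close>
  have quad: "0 \<le> 2 * t * (r \<bullet> r) + t\<^sup>2 * d" for t
  proof -
    have "(s * norm (u + t *\<^sub>R r))\<^sup>2 \<le> (norm (A *v (u + t *\<^sub>R r)))\<^sup>2"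
      by (intro power_mono bound) (simp add: s_def)
    moreover have "(norm (A *v (u + t *\<^sub>R r)))\<^sup>2
        = s\<^sup>2 + 2 * t * ((A *v u) \<bullet> (A *v r)) + t\<^sup>2 * (norm (A *v r))\<^sup>2"
      unfolding s_def power2_norm_eq_inner
      by (simp add: matrix_vector_right_distrib matrix_vector_mult_scaleR inner_simps
          inner_commute power2_eq_square algebra_simps)
    moreover have "(norm (u + t *\<^sub>R r))\<^sup>2 = 1 + 2 * t * (u \<bullet> r) + t\<^sup>2 * (norm r)\<^sup>2"
      using u unfolding norm_eq_1 power2_norm_eq_inner
      by (simp add: inner_simps inner_commute power2_eq_square algebra_simps)
    moreover have "((transpose A ** A) *v u) \<bullet> r = r \<bullet> r + s\<^sup>2 * (u \<bullet> r)"
      by (simp add: r_def flip: inner_scaleR_left inner_add_left)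
    ultimately show ?thesis
      unfolding adj d_def by (simp add: power_mult_distrib algebra_simps)
  qed
  have "r = 0"
  proof (rule ccontr)
    assume "r \<noteq> 0"
    \<comment> \<open>A step against the gradient. The denominator \<open>d + 1\<close> stays
      positive even for \<open>d = 0\<close> and makes the form strictly negative.\<close>
    define t where "t = - (r \<bullet> r) / (d + 1)"
    have t: "t \<noteq> 0" "r \<bullet> r = - t * (d + 1)"
      using \<open>r \<noteq> 0\<close> d by (simp_all add: t_def)
    have "2 * t * (r \<bullet> r) + t\<^sup>2 * d = - (t\<^sup>2 * (d + 2))"
      unfolding t(2) by (simp add: power2_eq_square algebra_simps)
    moreover have "t\<^sup>2 * (d + 2) > 0"
      using t(1) d by simp
    ultimately show False
      using quad[of t] by simp
  qed
  then have "s \<in> singular_values A"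
    using u unfolding singular_values_def r_def s_def by (auto intro!: exI[of _ u])
  then show ?thesis
    using bound by (rule that)
qed

lemma s_min_in_singular_values: "s_min A \<in> singular_values A"
  unfolding s_min_def
  by (metis Min_in empty_iff finite_singular_values singular_value_lower_bound)

text \<open>The lower bound is available for some singular value \<open>s\<close>, and the minimum
  is at most \<open>s\<close>.\<close>

lemma s_min_mult_norm_le: "s_min A * norm v \<le> norm (A *v v)"
proof -
  obtain s where s: "s \<in> singular_values A" "\<And>v. s * norm v \<le> norm (A *v v)"
    using singular_value_lower_bound by blast
  have "s_min A \<le> s"
    unfolding s_min_def using s(1) by (intro Min_le finite_singular_values)
  then have "s_min A * norm v \<le> s * norm v"
    by (simp add: mult_right_mono)
  also have "\<dots> \<le> norm (A *v v)"
    by (rule s(2))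
  finally show ?thesis .
qed

text \<open>A zero singular value would come with a nonzero kernel vector of the invertible matrix
  \<open>transpose A ** A\<close>.\<close>

lemma s_min_pos:
  assumes "invertible A"
  shows "s_min A > 0"
proof -
  obtain v where v: "s_min A \<ge> 0" "v \<noteq> 0" "(transpose A ** A) *v v = (s_min A)\<^sup>2 *\<^sub>R v"
    using s_min_in_singular_values[of A] by (auto simp: singular_values_def)
  have "invertible (transpose A ** A)"
    using assms by (simp add: invertible_mult transpose_invertible)
  then have "(transpose A ** A) *v v \<noteq> 0"
    using v(2) by (metis invertible_def matrix_left_invertible_ker)
  then show ?thesis
    using v by (cases "s_min A = 0") auto
qed

lemma norm_matrix_inv_le:
  fixes A :: "real ^ 'n ^ 'n"
  assumes "invertible A"
  shows "norm (matrix_inv A *v w) \<le> norm w / s_min A"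
  using s_min_mult_norm_le[of A "matrix_inv A *v w"] s_min_pos[OF assms] assms
  by (simp add: matrix_vector_mul_assoc matrix_inv_invertible(1) pos_le_divide_eq mult.commute)

subsection \<open>Block vectors and the saddle-point matrix\<close>

lemma sum_UNIV_Plus:
  fixes f :: "'m::finite + 'n::finite \<Rightarrow> 'a::comm_monoid_add"
  shows "sum f UNIV = (\<Sum>i\<in>UNIV. f (Inl i)) + (\<Sum>j\<in>UNIV. f (Inr j))"
  by (simp add: UNIV_Plus_UNIV[symmetric] sum.Plus del: UNIV_Plus_UNIV)

lemma block_vec_nth [simp]:
  "block_vec x y $ Inl i = x $ i" "block_vec x y $ Inr j = y $ j"
  by (simp_all add: block_vec_def)

lemma block_mat_nth [simp]:
  "block_mat A B C D $ Inl i $ Inl k = A $ i $ k"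
  "block_mat A B C D $ Inl i $ Inr l = B $ i $ l"
  "block_mat A B C D $ Inr j $ Inl k = C $ j $ k"
  "block_mat A B C D $ Inr j $ Inr l = D $ j $ l"
  by (simp_all add: block_mat_def)

lemma block_vec_eqI:
  assumes "\<And>i. v $ Inl i = x $ i" "\<And>j. v $ Inr j = y $ j"
  shows "v = block_vec x y"
  using assms by (simp add: vec_eq_iff split_sum_all)

lemma block_vec_cases:
  obtains x y where "v = block_vec x y"
  using block_vec_eqI[of v "\<chi> i. v $ Inl i" "\<chi> j. v $ Inr j"] by simp

lemma block_vec_add: "block_vec x y + block_vec x' y' = block_vec (x + x') (y + y')"
  by (rule block_vec_eqI) simp_all

lemma block_vec_eq_zero_iff: "block_vec x y = 0 \<longleftrightarrow> x = 0 \<and> y = 0"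
  by (simp add: vec_eq_iff split_sum_all)

lemma norm_block_vec_zero: "norm (block_vec x (0 :: real ^ 'n)) = norm x"
  by (simp add: norm_eq_sqrt_inner inner_vec_def sum_UNIV_Plus)

lemma block_mat_mult_block_vec:
  "block_mat A B C D *v block_vec x y = block_vec (A *v x + B *v y) (C *v x + D *v y)"
  by (rule block_vec_eqI) (simp_all add: matrix_vector_mult_def sum_UNIV_Plus)

lemma saddle_matrix_mult_block_vec:
  "saddle_matrix L\<eta> (Lz :: real ^ 'n ^ 'm) \<xi> *v block_vec x z =
    block_vec ((\<xi> * real CARD('m)) *\<^sub>R x + L\<eta> *v (transpose L\<eta> *v x) + Lz *v z)
      (transpose Lz *v x)"
  by (simp add: saddle_matrix_def block_mat_mult_block_vec matrix_vector_mult_add_rdistrib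
      scaleR_matrix_vector_assoc[symmetric] matrix_vector_mul_assoc
      del: transpose_matrix_vector)

text \<open>Testing the first block row of a kernel element against its first component kills the
  coupling term, and positivity of \<open>\<xi>\<close> then makes that component vanish.\<close>

lemma invertible_saddle_matrix:
  fixes L\<eta> :: "real ^ 'm ^ 'm" and Lz :: "real ^ 'n ^ 'm"
  assumes "\<xi> > 0" and rank: "rank Lz = CARD('n)"
  shows "invertible (saddle_matrix L\<eta> Lz \<xi>)"
proof -
  have "v = 0" if ker: "saddle_matrix L\<eta> Lz \<xi> *v v = 0" for v
  proof -
    obtain x z where v: "v = block_vec x z"
      by (rule block_vec_cases)
    have eq1: "(\<xi> * real CARD('m)) *\<^sub>R x + L\<eta> *v (transpose L\<eta> *v x) + Lz *v z = 0"
      and eq2: "transpose Lz *v x = 0"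
      using ker by (simp_all add: v saddle_matrix_mult_block_vec block_vec_eq_zero_iff)
    \<comment> \<open>The second block row makes \<open>x\<close> orthogonal to the range of
      \<open>Lz\<close>.\<close>
    have "x \<bullet> (Lz *v z) = 0"
      using eq2 by (simp flip: dot_lmul_matrix)
    moreover have "x \<bullet> (L\<eta> *v (transpose L\<eta> *v x)) = (norm (transpose L\<eta> *v x))\<^sup>2"
      by (simp add: power2_norm_eq_inner flip: dot_lmul_matrix)
    ultimately have "\<xi> * real CARD('m) * (x \<bullet> x) + (norm (transpose L\<eta> *v x))\<^sup>2 = 0"
      using arg_cong[OF eq1, of "\<lambda>w. x \<bullet> w"] by (simp add: inner_add_right)
    moreover have "\<xi> * real CARD('m) * (x \<bullet> x) \<ge> 0"
      using \<open>\<xi> > 0\<close> by simp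
    ultimately have "\<xi> * real CARD('m) * (x \<bullet> x) = 0"
      by (smt (verit) zero_le_power2)
    then have "x = 0"
      using \<open>\<xi> > 0\<close> by simp
    \<comment> \<open>With \<open>x = 0\<close> the first block row reduces to
      \<open>Lz *v z = 0\<close>, and full column rank finishes.\<close>
    then have "Lz *v z = Lz *v 0"
      using eq1 by simp
    then have "z = 0"
      using rank full_rank_injective[of Lz] injD by metis
    with \<open>x = 0\<close> show ?thesis
      by (simp add: v block_vec_eq_zero_iff)
  qed
  then show ?thesis
    using invertible_left_inverse matrix_left_invertible_ker by blast
qed

text \<open>The projection keeps only the first block of columns of \<open>B\<close>, so the trace
  is the squared Frobenius norm of that block, collected here column by column.\<close>

lemma trace_mult_block_projection:
  fixes B :: "real ^ ('m::finite + 'n::finite) ^ ('m + 'n)"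
  shows "trace (B ** block_mat (mat 1) 0 0 0 ** transpose B)
    = (\<Sum>m\<in>UNIV. (norm (B *v block_vec (axis m 1) (0 :: real ^ 'n)))\<^sup>2)"
proof -
  have col: "(B *v block_vec (axis m 1) (0 :: real ^ 'n)) $ i = B $ i $ Inl m" for m i
    by (simp add: matrix_vector_mult_def sum_UNIV_Plus axis_def if_distrib cong: if_cong)
  have proj: "(B ** block_mat (mat 1) 0 0 0) $ i $ k
      = (case k of Inl m \<Rightarrow> B $ i $ Inl m | Inr _ \<Rightarrow> 0)"
    for i k
    by (cases k) (simp_all add: matrix_matrix_mult_def sum_UNIV_Plus mat_def if_distrib cong: if_cong)
  have "trace (B ** block_mat (mat 1) 0 0 0 ** transpose B)
      = (\<Sum>i\<in>UNIV. \<Sum>m\<in>UNIV. B $ i $ Inl m * B $ i $ Inl m)"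
    unfolding trace_def matrix_matrix_mult_def[of "B ** _"]
    by (simp add: proj sum_UNIV_Plus[where f = "\<lambda>k. (case k of Inl _ \<Rightarrow> _ k | Inr _ \<Rightarrow> _) * _ k"]
        sum_UNIV_Plus transpose_def)
  also have "\<dots> = (\<Sum>m\<in>UNIV. \<Sum>i\<in>UNIV. B $ i $ Inl m * B $ i $ Inl m)"
    by (rule sum.swap)
  finally show ?thesis
    by (simp only: power2_norm_eq_inner inner_vec_def col inner_real_def)
qed

subsection \<open>Affine images of independent centred noise\<close>

context prob_space
begin

lemma expectation_affine_noise:
  fixes b :: "'m::finite \<Rightarrow> 'v::euclidean_space"
  assumes "\<And>m. integrable M (\<epsilon> m)" and "\<And>m. expectation (\<epsilon> m) = 0"
  shows "expectation (\<lambda>\<omega>. c + (\<Sum>m\<in>UNIV. \<epsilon> m \<omega> *\<^sub>R b m)) = c"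
  using assms by (simp add: prob_space)

text \<open>After expanding the square, the linear terms have mean zero and the covariances
  \<sigma>^2 \<delta> leave only the diagonal of the double sum.\<close>

lemma expectation_norm_affine_noise:
  fixes b :: "'m::finite \<Rightarrow> 'v::euclidean_space"
  assumes indep: "indep_vars (\<lambda>_. borel) \<epsilon> UNIV"
    and int: "\<And>m. integrable M (\<epsilon> m)"
    and int2: "\<And>m. integrable M (\<lambda>\<omega>. (\<epsilon> m \<omega>)\<^sup>2)"
    and mean: "\<And>m. expectation (\<epsilon> m) = 0"
    and var: "\<And>m. expectation (\<lambda>\<omega>. (\<epsilon> m \<omega>)\<^sup>2) = \<sigma>\<^sup>2"
  shows "expectation (\<lambda>\<omega>. (norm (c + (\<Sum>m\<in>UNIV. \<epsilon> m \<omega> *\<^sub>R b m)))\<^sup>2)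
    = (norm c)\<^sup>2 + \<sigma>\<^sup>2 * (\<Sum>m\<in>UNIV. (norm (b m))\<^sup>2)"
proof -
  have cov: "integrable M (\<lambda>\<omega>. \<epsilon> m \<omega> * \<epsilon> k \<omega>) \<and>
      expectation (\<lambda>\<omega>. \<epsilon> m \<omega> * \<epsilon> k \<omega>) = (if m = k then \<sigma>\<^sup>2 else 0)" for m k
  proof (cases "m = k")
    case True
    then show ?thesis
      using int2[of k] var[of k] by (simp add: power2_eq_square)
  next
    case False
    then have "indep_var borel (\<epsilon> m) borel (\<epsilon> k)"
      \<comment> \<open>Pairwise independence is the case of a sum over the singleton
        \<open>{k}\<close>.\<close>
      using indep_vars_sum[of "{k}" m \<epsilon>] indep_vars_subset[OF indep] by simp
    then show ?thesis
      using False int mean indep_var_integrable[of "\<epsilon> m" "\<epsilon> k"]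
        indep_var_lebesgue_integral[of "\<epsilon> m" "\<epsilon> k"]
      by simp
  qed
  have "(norm (c + (\<Sum>m\<in>UNIV. \<epsilon> m \<omega> *\<^sub>R b m)))\<^sup>2
      = (norm c)\<^sup>2 + 2 * (\<Sum>m\<in>UNIV. \<epsilon> m \<omega> * (c \<bullet> b m))
        + (\<Sum>m\<in>UNIV. \<Sum>k\<in>UNIV. (\<epsilon> m \<omega> * \<epsilon> k \<omega>) * (b m \<bullet> b k))" for \<omega>
  proof -
    have "(\<Sum>m\<in>UNIV. \<epsilon> m \<omega> *\<^sub>R b m) \<bullet> (\<Sum>k\<in>UNIV. \<epsilon> k \<omega> *\<^sub>R b k)
        = (\<Sum>m\<in>UNIV. \<Sum>k\<in>UNIV. (\<epsilon> m \<omega> * \<epsilon> k \<omega>) * (b m \<bullet> b k))"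
      by (simp add: inner_sum_left inner_sum_right sum_distrib_left inner_commute ac_simps)
    moreover have "c \<bullet> (\<Sum>m\<in>UNIV. \<epsilon> m \<omega> *\<^sub>R b m) = (\<Sum>m\<in>UNIV. \<epsilon> m \<omega> * (c \<bullet> b m))"
      by (simp add: inner_sum_right)
    ultimately show ?thesis
      by (simp add: power2_norm_eq_inner inner_add_left inner_add_right inner_commute)
  qed
  then have "expectation (\<lambda>\<omega>. (norm (c + (\<Sum>m\<in>UNIV. \<epsilon> m \<omega> *\<^sub>R b m)))\<^sup>2)
      = (norm c)\<^sup>2 + (\<Sum>m\<in>UNIV. \<Sum>k\<in>UNIV. (if m = k then \<sigma>\<^sup>2 else 0) * (b m \<bullet> b k))"
    using cov int mean by (simp add: prob_space)
  also have "(\<Sum>m\<in>UNIV. \<Sum>k\<in>UNIV. (if m = k then \<sigma>\<^sup>2 else 0) * (b m \<bullet> b k))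
      = \<sigma>\<^sup>2 * (\<Sum>m\<in>UNIV. (norm (b m))\<^sup>2)"
    by (simp add: if_distrib[of "\<lambda>x. x * _"] sum_distrib_left power2_norm_eq_inner cong: if_cong)
  finally show ?thesis .
qed

end

section \<open>Bias and mean square error of the regularized solution\<close>

theorem proposition3p2:
  fixes ell :: "'m::finite \<Rightarrow> ('x::{real_inner,complete_space} \<Rightarrow>\<^sub>L real)"
    and \<zeta> :: "'n::finite \<Rightarrow> 'x" and \<psi> :: "'m \<Rightarrow> 'x"
    and Z U :: "'x set"
    and L\<eta> :: "real ^ 'm ^ 'm" and Lz :: "real ^ 'n ^ 'm"
    and u_true :: 'x and \<xi> \<sigma> :: real
    and P :: "'w measure" and Q :: "'q measure"
    and e :: "'q \<Rightarrow> real" and \<epsilon> :: "'m \<Rightarrow> 'w \<Rightarrow> real"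
    and y :: "'w \<Rightarrow> real ^ 'm" and y_true :: "real ^ 'm"
    and \<eta>_star :: "'w \<Rightarrow> real ^ 'm" and z_star :: "'w \<Rightarrow> real ^ 'n"
    and u_star :: "'w \<Rightarrow> real ^ ('m + 'n)"
    and \<eta>_opt :: "real ^ 'm" and z_opt :: "real ^ 'n" and u_opt :: "real ^ ('m + 'n)"
    and A :: "real \<Rightarrow> real ^ ('m + 'n) ^ ('m + 'n)"
    and \<Sigma> :: "real ^ ('m + 'n) ^ ('m + 'n)"
  assumes basis_Z: "orthonormal_basis_of \<zeta> Z"
    and basis_U: "orthonormal_basis_of \<psi> U"
    and Lz: "Lz = observation_matrix ell \<zeta>"
    and L\<eta>: "L\<eta> = observation_matrix ell \<psi>"
    and unisolvent: "\<forall>\<phi>\<in>U. (\<forall>m. blinfun_apply (ell m) \<phi> = 0) \<longrightarrow> \<phi> = 0"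
    and rank_Lz: "rank Lz = CARD('n)"
    and \<xi>: "\<xi> > 0"
    and prob_P: "prob_space P"
    and prob_Q: "prob_space Q"
    and e_meas: "e \<in> borel_measurable Q"
    and e_integrable: "integrable Q e" "integrable Q (\<lambda>x. (e x)\<^sup>2)"
    and e_mean: "prob_space.expectation Q e = 0"
    and e_var: "prob_space.variance Q e = \<sigma>\<^sup>2"
    and \<epsilon>_indep: "prob_space.indep_vars P (\<lambda>_. borel) \<epsilon> UNIV"
    and \<epsilon>_law: "\<forall>m. distr P borel (\<epsilon> m) = distr Q borel e"
    and y: "\<forall>\<omega>\<in>space P. y \<omega> = (\<chi> m. blinfun_apply (ell m) u_true + \<epsilon> m \<omega>)"
    and y_true: "y_true = (\<chi> m. blinfun_apply (ell m) u_true)"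
    and A: "A = saddle_matrix L\<eta> Lz"
    and \<Sigma>: "\<Sigma> = block_mat (mat 1) 0 0 0"
    and u_star: "\<forall>\<omega>\<in>space P. u_star \<omega> = block_vec (\<eta>_star \<omega>) (z_star \<omega>)"
    and u_star_eq: "\<forall>\<omega>\<in>space P. A \<xi> *v u_star \<omega> = block_vec (y \<omega>) 0"
    and u_opt: "u_opt = block_vec \<eta>_opt z_opt"
    and u_opt_eq: "A 0 *v u_opt = block_vec y_true 0"
  shows "norm (prob_space.expectation P u_star - u_opt)
           \<le> \<xi> * real CARD('m) / s_min (A \<xi>) * norm \<eta>_opt
         \<and> prob_space.expectation P (\<lambda>\<omega>. (norm (u_star \<omega> - u_opt))\<^sup>2)
           \<le> (\<xi> * real CARD('m) / s_min (A \<xi>) * norm \<eta>_opt)\<^sup>2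
             + \<sigma>\<^sup>2 * trace (matrix_inv (A \<xi>) ** \<Sigma> ** transpose (matrix_inv (A \<xi>)))"
proof -
  interpret P: prob_space P by (fact prob_P)
  have \<epsilon>_meas [measurable]: "\<epsilon> m \<in> borel_measurable P" for m
    using \<epsilon>_indep by (auto simp: P.indep_vars_def)
  note e_meas [measurable]
  \<comment> \<open>Each noise component has the law of \<open>e\<close>, so its moments can be
    computed on \<open>Q\<close>.\<close>
  have transfer: "integrable P (\<lambda>\<omega>. f (\<epsilon> m \<omega>)) = integrable Q (\<lambda>x. f (e x))"
      "P.expectation (\<lambda>\<omega>. f (\<epsilon> m \<omega>)) = prob_space.expectation Q (\<lambda>x. f (e x))"
    if [measurable]: "f \<in> borel_measurable borel" for f :: "real \<Rightarrow> real" and m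
    using integrable_distr_eq[of "\<epsilon> m" P borel f] integrable_distr_eq[of e Q borel f]
      integral_distr[of "\<epsilon> m" P borel f] integral_distr[of e Q borel f] \<epsilon>_law
    by simp_all
  \<comment> \<open>Since \<open>e\<close> has mean zero, its variance is its second moment.\<close>
  have noise: "integrable P (\<epsilon> m)" "integrable P (\<lambda>\<omega>. (\<epsilon> m \<omega>)\<^sup>2)"
      "P.expectation (\<epsilon> m) = 0" "P.expectation (\<lambda>\<omega>. (\<epsilon> m \<omega>)\<^sup>2) = \<sigma>\<^sup>2" for m
    using transfer[of "\<lambda>x. x" m] transfer[of "\<lambda>x. x\<^sup>2" m] e_integrable e_mean e_var by simp_all

  \<comment> \<open>\<open>b m\<close> is the response of the solution to a unit change of the
    \<open>m\<close>-th datum; \<open>c\<close> is the bias.\<close>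
  define B where "B = matrix_inv (A \<xi>)"
  define b where "b m = B *v block_vec (axis m 1) (0 :: real ^ 'n)" for m :: 'm
  define c where "c = B *v block_vec (- (\<xi> * real CARD('m)) *\<^sub>R \<eta>_opt) (0 :: real ^ 'n)"
  have inv: "invertible (A \<xi>)"
    unfolding A using \<xi> rank_Lz by (rule invertible_saddle_matrix)
  \<comment> \<open>\<open>u_opt\<close> solves the \<xi>-system for data shifted by \<xi> M times
    its own first component, the only place where \<open>A 0\<close> and \<open>A \<xi>\<close>
    differ.\<close>
  have A_opt: "A \<xi> *v u_opt = block_vec (y_true + (\<xi> * real CARD('m)) *\<^sub>R \<eta>_opt) 0"
  proof -
    have "A \<xi> *v u_opt = A 0 *v u_opt + block_vec ((\<xi> * real CARD('m)) *\<^sub>R \<eta>_opt) 0"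
      by (simp add: A u_opt saddle_matrix_mult_block_vec block_vec_add ac_simps)
    then show ?thesis
      by (simp add: u_opt_eq block_vec_add)
  qed
  have error: "u_star \<omega> - u_opt = c + (\<Sum>m\<in>UNIV. \<epsilon> m \<omega> *\<^sub>R b m)" if "\<omega> \<in> space P" for \<omega>
  proof -
    have "A \<xi> *v (u_star \<omega> - u_opt)
        = block_vec (- (\<xi> * real CARD('m)) *\<^sub>R \<eta>_opt) 0
          + (\<Sum>m\<in>UNIV. \<epsilon> m \<omega> *\<^sub>R block_vec (axis m 1) 0)"
    proof -
      have "A \<xi> *v (u_star \<omega> - u_opt) = block_vec (y \<omega>) 0
          - block_vec (y_true + (\<xi> * real CARD('m)) *\<^sub>R \<eta>_opt) 0"
        using u_star_eq that A_opt by (simp add: matrix_vector_mult_diff_distrib)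
      also have "\<dots> = block_vec (- (\<xi> * real CARD('m)) *\<^sub>R \<eta>_opt) 0
          + block_vec (\<chi> m. \<epsilon> m \<omega>) 0"
        unfolding block_vec_add using y that y_true by (intro block_vec_eqI) simp_all
      also have "block_vec (\<chi> m. \<epsilon> m \<omega>) 0
          = (\<Sum>m\<in>UNIV. \<epsilon> m \<omega> *\<^sub>R block_vec (axis m 1) (0 :: real ^ 'n))"
        by (rule block_vec_eqI[symmetric])
          (simp_all add: axis_def if_distrib cong: if_cong)
      finally show ?thesis .
    qed
    then have "B *v (A \<xi> *v (u_star \<omega> - u_opt)) = c + (\<Sum>m\<in>UNIV. \<epsilon> m \<omega> *\<^sub>R b m)"
      by (simp add: c_def b_def matrix_vector_right_distrib matrix_vector_mult_scaleR
          linear_sum[OF matrix_vector_mul_linear])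
    then show ?thesis
      using inv by (simp add: B_def matrix_vector_mul_assoc matrix_inv_invertible(2))
  qed
  have c_le: "norm c \<le> \<xi> * real CARD('m) / s_min (A \<xi>) * norm \<eta>_opt"
    unfolding c_def B_def
    using norm_matrix_inv_le[OF inv, of "block_vec (- (\<xi> * real CARD('m)) *\<^sub>R \<eta>_opt) 0"] \<xi>
    by (simp add: norm_block_vec_zero)

  \<comment> \<open>The error formula holds on \<open>space P\<close>, which suffices under the
    integral; the mean error is then exactly \<open>c\<close>.\<close>
  have "P.expectation u_star = P.expectation (\<lambda>\<omega>. (u_opt + c) + (\<Sum>m\<in>UNIV. \<epsilon> m \<omega> *\<^sub>R b m))"
    using error by (intro Bochner_Integration.integral_cong) (auto simp: algebra_simps)
  also have "\<dots> = u_opt + c"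
    by (intro P.expectation_affine_noise noise)
  finally have bias: "norm (P.expectation u_star - u_opt) = norm c"
    by simp
  have "P.expectation (\<lambda>\<omega>. (norm (u_star \<omega> - u_opt))\<^sup>2)
      = P.expectation (\<lambda>\<omega>. (norm (c + (\<Sum>m\<in>UNIV. \<epsilon> m \<omega> *\<^sub>R b m)))\<^sup>2)"
    using error by (intro Bochner_Integration.integral_cong) auto
  also have "\<dots> = (norm c)\<^sup>2 + \<sigma>\<^sup>2 * (\<Sum>m\<in>UNIV. (norm (b m))\<^sup>2)"
    by (intro P.expectation_norm_affine_noise \<epsilon>_indep noise)
  also have "(\<Sum>m\<in>UNIV. (norm (b m))\<^sup>2) = trace (B ** \<Sigma> ** transpose B)"
    by (simp add: \<Sigma> b_def trace_mult_block_projection)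
  finally have "P.expectation (\<lambda>\<omega>. (norm (u_star \<omega> - u_opt))\<^sup>2)
      = (norm c)\<^sup>2 + \<sigma>\<^sup>2 * trace (B ** \<Sigma> ** transpose B)" .
  \<comment> \<open>The mean square error has been computed exactly, so the inequality comes from
    estimating the bias alone.\<close>
  moreover have "(norm c)\<^sup>2 \<le> (\<xi> * real CARD('m) / s_min (A \<xi>) * norm \<eta>_opt)\<^sup>2"
    using c_le by (intro power_mono) simp_all
  ultimately show ?thesis
    using bias c_le by (simp add: B_def)
qed

end
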